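(* Let $G=(V,E)$ be an undirected graph, $M\subseteq E$ a matching, and $G_M=(V',E_M)$ the directed graph defined below. Then there exists an $M$-augmenting path in $G$ if and only if there exists a strongly simple path from $s$ to $t$ in $G_M$.
   Context: A matching $M\subseteq E$ is a set of edges no two of which share a node; a node is $M$-free if it is incident to no edge of $M$, and $V_M$ denotes the set of $M$-free nodes. An $M$-augmenting path is a simple path $v_0,\dots,v_k$ in $G$ whose edges alternate between $E\setminus M$ and $M$ and whose end nodes $v_0,v_k$ are both $M$-free. The directed graph $G_M=(V',E_M)$ is defined by $V'=\{[v,A],[v,B]\mid v\in V\}\cup\{s,t\}$ with $s,t$ two new distinct nodes, and $E_M=\{([v,A],[w,B]),([w,A],[v,B])\mid (v,w)\in M\}\cup\{([x,B],[y,A]),([y,B],[x,A])\mid (x,y)\in E\setminus M\}\cup\{(s,[v,B]),([v,A],t)\mid v\in V_M\}$. A path in $G_M$ is strongly simple if it is simple (no repeated node) and for no $v\in V$ does it contain both $[v,A]$ and $[v,B]$. *)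

theory Defs
  imports "Graph_Theory.Graph_Theory"
begin

section \<open>Undirected graphs and matchings\<close>

text \<open>
  Undirected edges are unordered pairs \<^term>\<open>{u, v}\<close> of nodes. Finiteness is not required and
  loops (\<^term>\<open>u = v\<close>) are not excluded; neither simple paths nor strongly simple paths
  can traverse a loop.
\<close>

definition undirected_graph :: "'v set \<Rightarrow> 'v set set \<Rightarrow> bool" where
  "undirected_graph V E \<longleftrightarrow> (\<forall>e\<in>E. \<exists>u\<in>V. \<exists>v\<in>V. e = {u, v})"

definition is_matching :: "'v set set \<Rightarrow> 'v set set \<Rightarrow> bool" where
  "is_matching E M \<longleftrightarrow> M \<subseteq> E \<and> (\<forall>e\<in>M. \<forall>f\<in>M. e \<noteq> f \<longrightarrow> e \<inter> f = {})"

definition free_nodes :: "'v set \<Rightarrow> 'v set set \<Rightarrow> 'v set" where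
  "free_nodes V M = {v \<in> V. \<forall>e\<in>M. v \<notin> e}"

definition simple_path :: "'v set \<Rightarrow> 'v set set \<Rightarrow> 'v list \<Rightarrow> bool" where
  "simple_path V E p \<longleftrightarrow>
     p \<noteq> [] \<and> set p \<subseteq> V \<and> successively (\<lambda>u v. {u, v} \<in> E) p \<and> distinct p"

definition alternating :: "'v set set \<Rightarrow> 'v list \<Rightarrow> bool" where
  "alternating M p \<longleftrightarrow>
     (\<forall>i. i + 2 < length p \<longrightarrow> ({p ! i, p ! (i + 1)} \<in> M \<longleftrightarrow> {p ! (i + 1), p ! (i + 2)} \<notin> M))"

text \<open>
  An augmenting path has at least one edge: a single free node is not an augmenting path.
\<close>

definition augmenting_path :: "'v set \<Rightarrow> 'v set set \<Rightarrow> 'v set set \<Rightarrow> 'v list \<Rightarrow> bool" where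
  "augmenting_path V E M p \<longleftrightarrow>
     simple_path V E p \<and> 2 \<le> length p \<and> alternating M p \<and>
     hd p \<in> free_nodes V M \<and> last p \<in> free_nodes V M"


section \<open>The directed graph of a matching\<close>

datatype 'v gm_node = NodeA 'v | NodeB 'v | Source | Sink

text \<open>
  Since \<^term>\<open>{v, w} = {w, v}\<close>, the comprehensions over matching and non-matching edges
  contribute both arcs arising from an edge.
\<close>

definition gm_graph :: "'v set \<Rightarrow> 'v set set \<Rightarrow> 'v set set \<Rightarrow> 'v gm_node pair_pre_digraph" where
  "gm_graph V E M =
     \<lparr> pverts = NodeA ` V \<union> NodeB ` V \<union> {Source, Sink},
       parcs = {(NodeA v, NodeB w) | v w. {v, w} \<in> M}
             \<union> {(NodeB x, NodeA y) | x y. {x, y} \<in> E - M}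
             \<union> {(Source, NodeB v) | v. v \<in> free_nodes V M}
             \<union> {(NodeA v, Sink) | v. v \<in> free_nodes V M} \<rparr>"

lemma pair_wf_digraph_gm_graph:
  assumes "undirected_graph V E" "is_matching E M"
  shows "pair_wf_digraph (gm_graph V E M)"
proof -
  have "u \<in> V \<and> v \<in> V" if "{u, v} \<in> E" for u v
    using assms(1) that unfolding undirected_graph_def by (metis doubleton_eq_iff)
  then show ?thesis
    using assms(2)
    by unfold_locales (auto simp: gm_graph_def is_matching_def free_nodes_def)
qed

text \<open>
  Paths in the directed graph are arc lists; \<^const>\<open>pre_digraph.apath\<close> is the
  library's notion of a walk without repeated nodes.
\<close>

definition strongly_simple_path ::
  "'v set \<Rightarrow> 'v set set \<Rightarrow> 'v set set \<Rightarrow> 'v gm_node \<Rightarrow> ('v gm_node \<times> 'v gm_node) awalk \<Rightarrow> 'v gm_node \<Rightarrow> bool" where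
  "strongly_simple_path V E M a p b \<longleftrightarrow>
     pre_digraph.apath (with_proj (gm_graph V E M)) a p b \<and>
     \<not> (\<exists>v\<in>V. NodeA v \<in> set (pre_digraph.awalk_verts (with_proj (gm_graph V E M)) a p)
            \<and> NodeB v \<in> set (pre_digraph.awalk_verts (with_proj (gm_graph V E M)) a p))"

end

theory Submission
  imports Defs
begin

text \<open>
  The nodes of an \<open>M\<close>-augmenting path, labelled alternately \<open>B, A, B, A, \<dots>\<close> and enclosed between
  \<open>s\<close> and \<open>t\<close>, form a strongly simple path. Conversely, the arcs of \<open>G\<^sub>M\<close> force the labels of every
  path from \<open>s\<close> to \<open>t\<close> to alternate in this way, so its node sequence alternates with respect to \<open>M\<close>;
  strong simplicity says exactly that this sequence has no repetition.
\<close>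

section \<open>Arc lists and node lists of walks\<close>

lemma awalk_with_proj_imp_verts:
  fixes G :: "'a pair_pre_digraph"
  assumes "pre_digraph.cas (with_proj G) u q v" and "set q \<subseteq> parcs G"
  shows "hd (pre_digraph.awalk_verts (with_proj G) u q) = u"
    and "last (pre_digraph.awalk_verts (with_proj G) u q) = v"
    and "successively (\<lambda>x y. (x, y) \<in> parcs G) (pre_digraph.awalk_verts (with_proj G) u q)"
proof -
  interpret pre_digraph "with_proj G" .
  have "hd (awalk_verts u q) = u \<and> last (awalk_verts u q) = v \<and>
      successively (\<lambda>x y. (x, y) \<in> parcs G) (awalk_verts u q)"
    using assms
    by (induction q arbitrary: u) (auto simp: successively_Cons)
  then show "hd (awalk_verts u q) = u" "last (awalk_verts u q) = v"
    "successively (\<lambda>x y. (x, y) \<in> parcs G) (awalk_verts u q)"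
    by auto
qed

text \<open>In a pair digraph an arc is the pair of its end nodes, so the arc list is read off from
  consecutive nodes; a single node gives the empty arc list.\<close>

lemma awalk_with_proj_of_verts:
  fixes G :: "'a pair_pre_digraph"
  assumes "successively (\<lambda>x y. (x, y) \<in> parcs G) (u # xs)"
  shows "\<exists>q. pre_digraph.awalk_verts (with_proj G) u q = u # xs \<and> set q \<subseteq> parcs G \<and>
      pre_digraph.cas (with_proj G) u q (last (u # xs))"
proof -
  interpret pre_digraph "with_proj G" .
  show ?thesis
    using assms
  proof (induction xs arbitrary: u)
    case Nil
    show ?case by (rule exI[of _ "[]"]) simp
  next
    case (Cons w xs)
    then obtain q where "awalk_verts w q = w # xs" "set q \<subseteq> parcs G" "cas w q (last (w # xs))"
      by (auto simp: successively_Cons)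
    then show ?case
      using Cons.prems by (intro exI[of _ "(u, w) # q"]) auto
  qed
qed

text \<open>Trades library paths, which are arc lists, for plain node lists. \<open>P\<close> is the
  slot for the extra condition of strong simplicity.\<close>

lemma ex_apath_with_proj_iff:
  fixes G :: "'a pair_pre_digraph"
  assumes "u \<in> pverts G"
  shows "(\<exists>q. pre_digraph.apath (with_proj G) u q v \<and>
        P (pre_digraph.awalk_verts (with_proj G) u q)) \<longleftrightarrow>
      (\<exists>xs. xs \<noteq> [] \<and> hd xs = u \<and> last xs = v \<and>
        successively (\<lambda>x y. (x, y) \<in> parcs G) xs \<and> distinct xs \<and> P xs)"
    (is "?L \<longleftrightarrow> ?R")
proof
  assume ?L
  then obtain q where q: "pre_digraph.cas (with_proj G) u q v" "set q \<subseteq> parcs G"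
    "distinct (pre_digraph.awalk_verts (with_proj G) u q)"
    "P (pre_digraph.awalk_verts (with_proj G) u q)"
    by (auto simp: pre_digraph.apath_def pre_digraph.awalk_def)
  then show ?R
    using awalk_with_proj_imp_verts[OF q(1,2)]
    by (intro exI[of _ "pre_digraph.awalk_verts (with_proj G) u q"])
      (simp add: pre_digraph.awalk_verts_non_Nil)
next
  assume ?R
  then obtain ys where ys: "ys \<noteq> []" "hd ys = u" "last ys = v"
    "successively (\<lambda>x y. (x, y) \<in> parcs G) ys" "distinct ys" "P ys"
    by blast
  then obtain xs where xs: "ys = u # xs"
    by (cases ys) auto
  obtain q where "pre_digraph.awalk_verts (with_proj G) u q = ys" "set q \<subseteq> parcs G"
    "pre_digraph.cas (with_proj G) u q v"
    using awalk_with_proj_of_verts[OF ys(4)[unfolded xs]] ys(3) unfolding xs by blast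
  then show ?L
    using assms ys(5,6)
    by (intro exI[of _ q]) (simp add: pre_digraph.apath_def pre_digraph.awalk_def)
qed

section \<open>Walks from \<open>Source\<close> to \<open>Sink\<close> as labelled node
  sequences\<close>

fun label_path :: "bool \<Rightarrow> 'v list \<Rightarrow> 'v gm_node list" where
  "label_path b [] = []"
| "label_path b (v # p) = (if b then NodeB v else NodeA v) # label_path (\<not> b) p"

text \<open>The flag is that of \<open>label_path\<close>: arcs from a B copy to an A copy stem from
  non-matching edges, arcs from an A copy to a B copy from matching edges.\<close>

fun alternating_walk :: "'v set set \<Rightarrow> 'v set set \<Rightarrow> bool \<Rightarrow> 'v list \<Rightarrow> bool" where
  "alternating_walk E M b (u # v # p) \<longleftrightarrow>
     {u, v} \<in> (if b then E - M else M) \<and> alternating_walk E M (\<not> b) (v # p)"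
| "alternating_walk E M b p \<longleftrightarrow> True"

lemma gm_graph_arc_iff:
  "(NodeA v, NodeB w) \<in> parcs (gm_graph V E M) \<longleftrightarrow> {v, w} \<in> M"
  "(NodeB v, NodeA w) \<in> parcs (gm_graph V E M) \<longleftrightarrow> {v, w} \<in> E - M"
  "(Source, NodeB v) \<in> parcs (gm_graph V E M) \<longleftrightarrow> v \<in> free_nodes V M"
  "(NodeA v, Sink) \<in> parcs (gm_graph V E M) \<longleftrightarrow> v \<in> free_nodes V M"
  "(NodeB v, Sink) \<notin> parcs (gm_graph V E M)"
  "(Sink, y) \<notin> parcs (gm_graph V E M)"
  by (auto simp: gm_graph_def)

lemma gm_graph_arc_cases:
  "(Source, y) \<in> parcs (gm_graph V E M) \<Longrightarrow> \<exists>v. y = NodeB v"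
  "(NodeA v, y) \<in> parcs (gm_graph V E M) \<Longrightarrow> y = Sink \<or> (\<exists>w. y = NodeB w)"
  "(NodeB v, y) \<in> parcs (gm_graph V E M) \<Longrightarrow> \<exists>w. y = NodeA w"
  by (auto simp: gm_graph_def)

lemma mem_set_label_path_iff:
  "NodeA v \<in> set (label_path b p) \<or> NodeB v \<in> set (label_path b p) \<longleftrightarrow> v \<in> set p"
  by (induction b p rule: label_path.induct) auto

lemma Source_Sink_notin_label_path:
  "Source \<notin> set (label_path b p)" "Sink \<notin> set (label_path b p)"
  by (induction b p rule: label_path.induct) auto

text \<open>A repeated node of \<open>p\<close> shows up either as the same copy twice or as both
  copies; distinctness excludes the former, strong simplicity the latter.\<close>

lemma distinct_label_path_iff:
  "distinct (label_path b p) \<and>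
     (\<forall>v. \<not> (NodeA v \<in> set (label_path b p) \<and> NodeB v \<in> set (label_path b p))) \<longleftrightarrow> distinct p"
proof (induction b p rule: label_path.induct)
  case (2 b v p)
  have "NodeA v \<notin> set (label_path (\<not> b) p) \<and> NodeB v \<notin> set (label_path (\<not> b) p) \<longleftrightarrow> v \<notin> set p"
    using mem_set_label_path_iff[of v "\<not> b" p] by blast
  then show ?case
    using 2 by (cases b) auto
qed simp

text \<open>Among labelled nodes only A copies have arcs to \<open>Sink\<close>, so the last label
  must be A; as the labels alternate starting from \<open>b\<close>, this is a parity
  condition.\<close>

lemma successively_label_path_Sink_iff:
  "successively (\<lambda>x y. (x, y) \<in> parcs (gm_graph V E M)) (label_path b (v # p) @ [Sink]) \<longleftrightarrow>
     alternating_walk E M b (v # p) \<and> last (v # p) \<in> free_nodes V M \<and> even (length p) = (\<not> b)"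
proof (induction p arbitrary: b v)
  case Nil
  show ?case by (cases b) (simp_all add: gm_graph_arc_iff)
next
  case (Cons w p)
  then show ?case
    using Cons.IH[of "\<not> b" w] by (cases b) (simp_all add: gm_graph_arc_iff conj_ac)
qed

text \<open>B copies have arcs only to A copies, A copies only to B copies or \<open>Sink\<close>,
  and no arc leaves \<open>Sink\<close>. So the labels are forced until the walk stops at its first
  \<open>Sink\<close>.\<close>

lemma walk_to_Sink_imp_label_path:
  assumes "successively (\<lambda>x y. (x, y) \<in> parcs (gm_graph V E M)) (x # xs)"
    and "last (x # xs) = Sink" and "x = (if b then NodeB v else NodeA v)"
  shows "\<exists>p. x # xs = label_path b (v # p) @ [Sink]"
  using assms
proof (induction xs arbitrary: x b v)
  case Nil
  then show ?case by (auto split: if_splits)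
next
  case (Cons y ys)
  show ?case
  proof (cases "y = Sink")
    case True
    then have "ys = []"
      using Cons.prems(1) by (cases ys) (auto simp: gm_graph_arc_iff)
    then show ?thesis
      using True Cons.prems(3) by (intro exI[of _ "[]"]) auto
  next
    case False
    then obtain w where "y = (if \<not> b then NodeB w else NodeA w)"
      using Cons.prems by (cases b) (auto dest!: gm_graph_arc_cases)
    then obtain p where "y # ys = label_path (\<not> b) (w # p) @ [Sink]"
      using Cons.IH[of y "\<not> b" w] Cons.prems by (auto simp: successively_Cons)
    then show ?thesis
      using Cons.prems(3) by (intro exI[of _ "w # p"]) auto
  qed
qed

lemma walk_Source_Sink_iff:
  "xs \<noteq> [] \<and> hd xs = Source \<and> last xs = Sink \<and>
     successively (\<lambda>x y. (x, y) \<in> parcs (gm_graph V E M)) xs \<longleftrightarrow>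
   (\<exists>p. xs = Source # label_path True p @ [Sink] \<and> p \<noteq> [] \<and> even (length p) \<and>
     alternating_walk E M True p \<and> hd p \<in> free_nodes V M \<and> last p \<in> free_nodes V M)"
    (is "?L \<longleftrightarrow> ?R")
proof
  assume L: ?L
  \<comment> \<open>The two ends differ, so the walk has a second node.\<close>
  then obtain y ys where xs: "xs = Source # y # ys"
    by (cases xs; cases "tl xs") auto
  then obtain v where v: "y = NodeB v" "v \<in> free_nodes V M"
    using L gm_graph_arc_cases(1)[of y V E M] by (auto simp: gm_graph_arc_iff)
  have succ: "successively (\<lambda>x y. (x, y) \<in> parcs (gm_graph V E M)) (y # ys)"
    using L xs by (auto simp: successively_Cons)
  then obtain p where p: "y # ys = label_path True (v # p) @ [Sink]"
    using walk_to_Sink_imp_label_path[of V E M y ys True v] L xs v by auto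
  show ?R
    using successively_label_path_Sink_iff[of V E M True v p] succ p xs v(2)
    by (intro exI[of _ "v # p"]) auto
next
  assume ?R
  then obtain v p where "xs = Source # label_path True (v # p) @ [Sink]" "odd (length p)"
    "alternating_walk E M True (v # p)" "v \<in> free_nodes V M" "last (v # p) \<in> free_nodes V M"
    by (metis list.collapse list.sel(1) even_Suc length_Cons)
  then show ?L
    using successively_label_path_Sink_iff[of V E M True v p] by (auto simp: gm_graph_arc_iff)
qed

section \<open>Alternating walks and augmenting paths in the undirected graph\<close>

lemma alternating_Cons_iff:
  "alternating M (u # v # w # p) \<longleftrightarrow>
     ({u, v} \<in> M \<longleftrightarrow> {v, w} \<notin> M) \<and> alternating M (v # w # p)"
proof -
  \<comment> \<open>Splitting off index 0 turns the index-based definition into a recursion on the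
    list.\<close>
  have split: "(\<forall>i. Q i) \<longleftrightarrow> Q 0 \<and> (\<forall>i. Q (Suc i))" for Q
    by (metis not0_implies_Suc)
  show ?thesis
    unfolding alternating_def
    by (subst split[of "\<lambda>i. i + 2 < length (u # v # w # p) \<longrightarrow> _ i"]) simp
qed

text \<open>Alternation determines the type of every edge once that of the first is known, and
  \<open>b\<close> prescribes the first.\<close>

lemma alternating_walk_iff:
  assumes "M \<subseteq> E"
  shows "alternating_walk E M b (u # v # p) \<longleftrightarrow>
     successively (\<lambda>x y. {x, y} \<in> E) (u # v # p) \<and> alternating M (u # v # p) \<and>
     ({u, v} \<in> M \<longleftrightarrow> \<not> b)"
proof (induction p arbitrary: b u v)
  case Nil
  then show ?case using assms by (auto simp: alternating_def)
next
  case (Cons w p)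
  show ?case
    using Cons.IH[of "\<not> b" v w] assms by (cases b) (auto simp: alternating_Cons_iff)
qed

text \<open>A matching edge cannot end in a free node, so the last edge is non-matching. Counted
  from 0 it is edge \<open>length p\<close>, and the types alternate starting from
  \<open>b\<close>.\<close>

lemma alternating_walk_length_parity:
  assumes "alternating_walk E M b (u # v # p)" and "last (u # v # p) \<in> free_nodes V M"
  shows "even (length p) = b"
  using assms
proof (induction p arbitrary: b u v)
  case Nil
  then show ?case by (auto simp: free_nodes_def split: if_splits)
next
  case (Cons w p)
  from Cons.IH[of "\<not> b" v w] Cons.prems show ?case by auto
qed

text \<open>In a list of at least two nodes each node lies on an edge, and edges have both ends in
  \<open>V\<close>.\<close>

lemma set_subset_if_successively_edges:
  assumes "undirected_graph V E" and "successively (\<lambda>x y. {x, y} \<in> E) (u # v # p)"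
  shows "set (u # v # p) \<subseteq> V"
proof -
  have "x \<in> V \<and> y \<in> V" if "{x, y} \<in> E" for x y
    using assms(1) that unfolding undirected_graph_def by (metis doubleton_eq_iff)
  then show ?thesis
    using assms(2) by (induction p arbitrary: u v) auto
qed

text \<open>A free first node makes the first edge non-matching, whence the flag
  \<open>True\<close>; a free last node then yields even length by the parity lemma.\<close>

lemma augmenting_path_iff_alternating_walk:
  assumes "undirected_graph V E" and "is_matching E M"
  shows "augmenting_path V E M p \<longleftrightarrow>
     p \<noteq> [] \<and> even (length p) \<and> distinct p \<and> alternating_walk E M True p \<and>
     hd p \<in> free_nodes V M \<and> last p \<in> free_nodes V M"
proof (cases "\<exists>u v r. p = u # v # r")
  case True
  then obtain u v r where p: "p = u # v # r" by blast
  have "M \<subseteq> E" using assms(2) by (simp add: is_matching_def)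
  moreover have "{u, v} \<notin> M" if "u \<in> free_nodes V M"
    using that by (auto simp: free_nodes_def)
  moreover have "even (length r)"
    if "alternating_walk E M True p" "last p \<in> free_nodes V M"
    using alternating_walk_length_parity[of E M True u v r V] that p by blast
  ultimately show ?thesis
    using alternating_walk_iff[of M E True u v r] set_subset_if_successively_edges[OF assms(1), of u v r]
    unfolding augmenting_path_def simple_path_def p by auto
next
  case False
  \<comment> \<open>Both sides fail here: the left needs two nodes, the right a nonempty list of
    even length.\<close>
  then have "length p \<le> 1"
    by (cases p; cases "tl p") auto
  then show ?thesis
    by (cases p) (auto simp: augmenting_path_def)
qed

theorem theorem2:
  fixes V :: "'v set" and E M :: "'v set set"
  assumes "undirected_graph V E" and "is_matching E M"
  shows "(\<exists>p. augmenting_path V E M p) \<longleftrightarrow>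
         (\<exists>q. strongly_simple_path V E M Source q Sink)"
proof -
  let ?P = "\<lambda>xs. \<not> (\<exists>v\<in>V. NodeA v \<in> set xs \<and> NodeB v \<in> set xs)"
  let ?Q = "\<lambda>p. p \<noteq> [] \<and> even (length p) \<and> alternating_walk E M True p \<and>
    hd p \<in> free_nodes V M \<and> last p \<in> free_nodes V M"
  \<comment> \<open>Strong simplicity quantifies over \<open>V\<close> only, whereas
    \<open>distinct_label_path_iff\<close> speaks of all nodes; this inclusion bridges the
    two.\<close>
  have sub: "set p \<subseteq> V" if "?Q p" for p
  proof -
    obtain u v r where "p = u # v # r"
      using \<open>?Q p\<close> by (cases p; cases "tl p") auto
    then show ?thesis
      using that assms alternating_walk_iff[of M E True u v r]
        set_subset_if_successively_edges[of V E u v r] by (simp add: is_matching_def)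
  qed
  \<comment> \<open>\<open>Source\<close> and \<open>Sink\<close> never occur as labels, so adding
    them creates no repetition.\<close>
  have dist: "distinct (Source # label_path True p @ [Sink]) \<and>
      ?P (Source # label_path True p @ [Sink]) \<longleftrightarrow> distinct p" if "?Q p" for p
    using sub[OF that] distinct_label_path_iff[of True p] mem_set_label_path_iff[of _ True p]
      Source_Sink_notin_label_path[of True p] by auto
  have "(\<exists>q. strongly_simple_path V E M Source q Sink) \<longleftrightarrow>
      (\<exists>xs. (xs \<noteq> [] \<and> hd xs = Source \<and> last xs = Sink \<and>
        successively (\<lambda>x y. (x, y) \<in> parcs (gm_graph V E M)) xs) \<and> distinct xs \<and> ?P xs)"
    unfolding strongly_simple_path_def
    by (subst ex_apath_with_proj_iff[where P = ?P]) (auto simp: gm_graph_def)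
  also have "\<dots> \<longleftrightarrow> (\<exists>p. ?Q p \<and> distinct p)"
    unfolding walk_Source_Sink_iff using dist by blast
  also have "\<dots> \<longleftrightarrow> (\<exists>p. augmenting_path V E M p)"
    unfolding augmenting_path_iff_alternating_walk[OF assms] by blast
  finally show ?thesis by simp
qed

end
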